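(* Let $C, A_1,\ldots,A_m \in \mathbb{S}^n$, $b \in \mathbb{R}^m$, and for a closed convex cone $\mathcal{K} \subseteq \mathbb{S}^n$ consider the conic optimization problem $$\inf\ \langle C,X\rangle \quad \text{s.t.}\quad \langle A_i,X\rangle = b_i \ (i=1,\ldots,m),\quad X\in\mathcal{K}.$$ Let $S \subseteq \mathbb{S}^n$ be an admissible partition subspace for this problem with $\mathcal{K} = \mathbb{S}^n_+$. Then $S$ is also an admissible partition subspace for the problem obtained by replacing $\mathcal{K}=\mathbb{S}^n_+$ by $\mathcal{K}=\mathcal{D}^n$ (with the same data $C, A_i, b$).
   Context: $\mathbb{S}^n$ is the space of real symmetric $n\times n$ matrices with the trace inner product $\langle X,Y\rangle=\mathrm{trace}(XY)$; $\mathbb{S}^n_+$ is the cone of positive semidefinite matrices; $\mathcal{D}^n = \mathbb{S}^n_+\cap\mathbb{R}^{n\times n}_+$ is the doubly nonnegative cone. Let $X_0\in\mathbb{S}^n$ satisfy $\langle A_i,X_0\rangle=b_i$ for all $i$ (such an $X_0$ is assumed to exist), and let $\mathcal{L}=\{X\in\mathbb{S}^n : \langle A_i,X\rangle = 0 \text{ for all } i\}$, so the affine constraints read $X\in X_0+\mathcal{L}$. A linear subspace $S\subseteq\mathbb{S}^n$ with orthogonal projection $P_S$ onto $S$ is called admissible for the problem with cone $\mathcal{K}$ if: (i) $P_S(\mathcal{K})\subseteq\mathcal{K}$; (ii) $P_S(X_0+\mathcal{L})\subseteq X_0+\mathcal{L}$; (iii) $P_S(C+\mathcal{L}^\perp)\subseteq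 C+\mathcal{L}^\perp$. A partition subspace is a subspace of $\mathbb{S}^n$ having a basis of $0/1$ matrices that sum to the all-ones matrix $J$ (equivalently, the basis elements are the characteristic matrices of the parts of a partition of $[n]\times[n]$). *)

theory Defs
  imports "HOL-Analysis.Analysis"
begin

definition sym_mats :: "(real^'n^'n) set" where
  "sym_mats = {X. transpose X = X}"

definition trace_inner :: "real^'n^'n \<Rightarrow> real^'n^'n \<Rightarrow> real" where
  "trace_inner X Y = trace (X ** Y)"

definition psd_cone :: "(real^'n^'n) set" where
  "psd_cone = {X \<in> sym_mats. \<forall>v. 0 \<le> v \<bullet> (X *v v)}"

definition nonneg_mats :: "(real^'n^'n) set" where
  "nonneg_mats = {X. \<forall>i j. 0 \<le> X $ i $ j}"

definition dnn_cone :: "(real^'n^'n) set" where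
  "dnn_cone = psd_cone \<inter> nonneg_mats"

text \<open>
  The orthogonal projection onto \<open>S\<close> with respect to the trace inner product. It is
  meaningful for a subspace \<open>S\<close> of the symmetric matrices and symmetric \<open>X\<close>; see
  \<open>orth_proj_ex1\<close> below.
\<close>

definition orth_proj :: "(real^'n^'n) set \<Rightarrow> real^'n^'n \<Rightarrow> real^'n^'n" where
  "orth_proj S X = (THE Y. Y \<in> S \<and> (\<forall>Z\<in>S. trace_inner (X - Y) Z = 0))"

text \<open>Orthogonal complement inside the space of symmetric matrices (not inside all matrices).\<close>

definition sym_orth_comp :: "(real^'n^'n) set \<Rightarrow> (real^'n^'n) set" where
  "sym_orth_comp W = {X \<in> sym_mats. \<forall>Y\<in>W. trace_inner X Y = 0}"

definition constraint_kernel :: "nat \<Rightarrow> (nat \<Rightarrow> real^'n^'n) \<Rightarrow> (real^'n^'n) set" where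
  "constraint_kernel m A = {X \<in> sym_mats. \<forall>i\<in>{1..m}. trace_inner (A i) X = 0}"

text \<open>
  The problem is given by the cone \<open>K\<close>, the cost matrix \<open>C\<close>, the constraint matrices
  \<open>A 1, \<dots>, A m\<close>, and the right-hand side \<open>b\<close>, which enters through a solution \<open>X0\<close> of the
  linear constraints; see \<open>affine_constraints_eq\<close> below.
\<close>

definition admissible ::
  "(real^'n^'n) set \<Rightarrow> real^'n^'n \<Rightarrow> nat \<Rightarrow> (nat \<Rightarrow> real^'n^'n) \<Rightarrow> real^'n^'n
    \<Rightarrow> (real^'n^'n) set \<Rightarrow> bool" where
  "admissible K C m A X0 S \<longleftrightarrow>
     subspace S \<and> S \<subseteq> sym_mats \<and>
     orth_proj S ` K \<subseteq> K \<and>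
     orth_proj S ` ((+) X0 ` constraint_kernel m A) \<subseteq> (+) X0 ` constraint_kernel m A \<and>
     orth_proj S ` ((+) C ` sym_orth_comp (constraint_kernel m A))
       \<subseteq> (+) C ` sym_orth_comp (constraint_kernel m A)"

definition partition_subspace :: "(real^'n^'n) set \<Rightarrow> bool" where
  "partition_subspace S \<longleftrightarrow>
     subspace S \<and> S \<subseteq> sym_mats \<and>
     (\<exists>B. independent B \<and> span B = S \<and>
          (\<forall>M\<in>B. \<forall>i j. M $ i $ j \<in> {0, 1}) \<and>
          \<Sum>B = (\<chi> i j. 1))"

lemma trace_inner_eq_inner:
  assumes "X \<in> sym_mats"
  shows "trace_inner X Y = X \<bullet> Y"
proof -
  have sym: "X $ i $ j = X $ j $ i" for i j
    using assms by (metis (mono_tags, lifting) mem_Collect_eq sym_mats_def transpose_def vec_lambda_beta)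
  have "(\<Sum>i\<in>UNIV. \<Sum>k\<in>UNIV. X$i$k * Y$k$i) = (\<Sum>i\<in>UNIV. \<Sum>k\<in>UNIV. X$k$i * Y$k$i)"
    by (intro sum.cong refl arg_cong2[where f = "(*)"] sym)
  also have "\<dots> = (\<Sum>k\<in>UNIV. \<Sum>i\<in>UNIV. X$k$i * Y$k$i)"
    by (rule sum.swap)
  finally show ?thesis
    by (simp add: trace_inner_def trace_def matrix_matrix_mult_def inner_vec_def)
qed

lemma subspace_sym_mats: "subspace sym_mats"
  by (auto simp: subspace_def sym_mats_def transpose_def vec_eq_iff)

lemma orth_proj_ex1:
  assumes S: "subspace S" "S \<subseteq> sym_mats" and X: "X \<in> sym_mats"
  shows "\<exists>!Y. Y \<in> S \<and> (\<forall>Z\<in>S. trace_inner (X - Y) Z = 0)"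
proof -
  have eq: "trace_inner (X - Y) Z = (X - Y) \<bullet> Z" if "Y \<in> S" for Y Z
    using that S X subspace_sym_mats by (intro trace_inner_eq_inner) (auto intro: subspace_diff)
  obtain Y W where YW: "Y \<in> span S" "\<And>Z. Z \<in> span S \<Longrightarrow> orthogonal W Z" "X = Y + W"
    using orthogonal_subspace_decomp_exists[of S X] by metis
  have sp: "span S = S" using S(1) by (simp only: span_eq_iff)
  show ?thesis
  proof (rule ex1I[of _ Y])
    show "Y \<in> S \<and> (\<forall>Z\<in>S. trace_inner (X - Y) Z = 0)"
    proof (intro conjI ballI)
      show mem: "Y \<in> S" using YW(1) sp by simp
      fix Z assume "Z \<in> S"
      thus "trace_inner (X - Y) Z = 0"
        using YW(2)[of Z] eq[OF mem, of Z] by (simp add: sp YW(3) orthogonal_def)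
    qed
  next
    fix Y' assume Y': "Y' \<in> S \<and> (\<forall>Z\<in>S. trace_inner (X - Y') Z = 0)"
    have d: "Y - Y' \<in> S" using Y' YW sp S by (auto intro: subspace_diff)
    have "(X - Y') \<bullet> (Y - Y') = 0" using Y' d eq by metis
    moreover have "(X - Y) \<bullet> (Y - Y') = 0" using YW d by (simp add: sp orthogonal_def)
    ultimately have "(Y - Y') \<bullet> (Y - Y') = 0" by (simp add: inner_diff_left)
    thus "Y' = Y" by simp
  qed
qed

lemma affine_constraints_eq:
  assumes X0: "X0 \<in> sym_mats" and b: "\<And>i. i \<in> {1..m} \<Longrightarrow> trace_inner (A i) X0 = b i"
  shows "(+) X0 ` constraint_kernel m A = {X \<in> sym_mats. \<forall>i\<in>{1..m}. trace_inner (A i) X = b i}"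
    (is "?l = ?r")
proof
  have add: "trace_inner M (X + Y) = trace_inner M X + trace_inner M Y" for M X Y :: "real^'n^'n"
    by (simp add: trace_inner_def matrix_add_ldistrib trace_add)
  show "?l \<subseteq> ?r"
    using X0 b subspace_sym_mats by (auto simp: constraint_kernel_def add intro: subspace_add)
  show "?r \<subseteq> ?l"
  proof
    fix X assume X: "X \<in> ?r"
    have "trace_inner (A i) (X - X0) = 0" if "i \<in> {1..m}" for i
      using add[of "A i" "X - X0" X0] X b[OF that] that by auto
    hence "X - X0 \<in> constraint_kernel m A"
      using X X0 subspace_sym_mats by (auto simp: constraint_kernel_def intro: subspace_diff)
    thus "X \<in> ?l" by (auto intro!: image_eqI[of _ _ "X - X0"])
  qed
qed

end

theory Submission
  imports Defs
begin

text \<open>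
  Only condition (i) depends on the cone, and the projection onto \<open>S\<close> already preserves
  positive semidefiniteness by assumption. What remains is that it preserves entrywise
  nonnegativity, and this holds for every partition subspace: projecting onto \<open>S\<close> averages a
  matrix over each part of the partition, and averages of nonnegative entries are nonnegative.

  The averaging property has two ingredients. A matrix \<open>Y \<in> S\<close> is constant on the support of
  each basis matrix \<open>M\<close> (lemma \<open>span_partition_constant_on_part\<close>), so with \<open>c\<close> its value there,
  \<open>Y \<bullet> M = c * (M \<bullet> M)\<close>. If \<open>Y\<close> is the projection of \<open>X\<close>, orthogonality of \<open>X - Y\<close> to \<open>M\<close> gives
  \<open>Y \<bullet> M = X \<bullet> M\<close>; hence \<open>c\<close> is the average of \<open>X\<close> over the part
  (lemma \<open>partition_subspace_orth_proj_nonneg\<close>).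
\<close>

lemma orth_proj_mem_orthogonal:
  assumes "subspace S" "S \<subseteq> sym_mats" "X \<in> sym_mats"
  shows "orth_proj S X \<in> S"
    and "Z \<in> S \<Longrightarrow> (X - orth_proj S X) \<bullet> Z = 0"
proof -
  have P: "orth_proj S X \<in> S \<and> (\<forall>Z\<in>S. trace_inner (X - orth_proj S X) Z = 0)"
    unfolding orth_proj_def by (rule theI'[OF orth_proj_ex1[OF assms]])
  then show mem: "orth_proj S X \<in> S" by blast
  have "X - orth_proj S X \<in> sym_mats"
    using mem assms subspace_sym_mats by (auto intro: subspace_diff)
  then show "(X - orth_proj S X) \<bullet> Z = 0" if "Z \<in> S"
    using P that trace_inner_eq_inner by metis
qed

text \<open>
  At a fixed position the basis matrices contribute zeros and ones adding up to one, so exactly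
  one of them is nonzero there: the supports partition the set of positions.
\<close>

lemma zero_one_partition_at:
  fixes B :: "(real^'n^'m) set"
  assumes fin: "finite B"
    and bin: "\<And>M i j. M \<in> B \<Longrightarrow> M $ i $ j \<in> {0, 1}"
    and ones: "\<Sum>B = (\<chi> i j. 1)"
  shows "\<exists>M\<in>B. M $ i $ j = 1"
    and "M \<in> B \<Longrightarrow> N \<in> B \<Longrightarrow> M \<noteq> N \<Longrightarrow> M $ i $ j = 1 \<Longrightarrow> N $ i $ j = 0"
proof -
  have one: "(\<Sum>M\<in>B. M $ i $ j) = 1" for i j
    using arg_cong[OF ones, of "\<lambda>Z. Z $ i $ j"] by simp
  show "\<exists>M\<in>B. M $ i $ j = 1"
  proof (rule ccontr)
    assume "\<not> ?thesis"
    then have "(\<Sum>M\<in>B. M $ i $ j) = 0" using bin by (intro sum.neutral) blast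
    then show False using one by simp
  qed
  show "N $ i $ j = 0" if "M \<in> B" "N \<in> B" "M \<noteq> N" "M $ i $ j = 1"
  proof -
    have nonneg: "0 \<le> L $ i $ j" if "L \<in> B" for L using bin[OF that, of i j] by auto
    have "(\<Sum>L\<in>{M, N}. L $ i $ j) \<le> (\<Sum>L\<in>B. L $ i $ j)"
      using that fin nonneg by (intro sum_mono2) auto
    then have "N $ i $ j \<le> 0" using that one[of i j] by simp
    then show ?thesis using nonneg[OF that(2)] by simp
  qed
qed

text \<open>
  By linearity it suffices to look at basis matrices, and on the support of \<open>M\<close> the matrix \<open>M\<close>
  is identically one while the others vanish.
\<close>

lemma span_partition_constant_on_part:
  fixes B :: "(real^'n^'m) set"
  assumes "finite B"
    and "\<And>M i j. M \<in> B \<Longrightarrow> M $ i $ j \<in> {0, 1}"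
    and "\<Sum>B = (\<chi> i j. 1)"
    and M: "M \<in> B" "M $ i $ j = 1" "M $ k $ l = 1"
    and Y: "Y \<in> span B"
  shows "Y $ k $ l = Y $ i $ j"
  using Y
proof (induction rule: span_induct_alt)
  case base
  show ?case by simp
next
  case (step c N Z)
  have "N $ k $ l = N $ i $ j"
  proof (cases "N = M")
    case False
    then show ?thesis
      using zero_one_partition_at(2)[OF assms(1-3) M(1) step(1)] M by metis
  qed (use M in simp)
  then show ?case using step by simp
qed

lemma partition_subspace_orth_proj_nonneg:
  fixes X :: "real^'n^'n"
  assumes S: "partition_subspace S" and X: "X \<in> sym_mats" "X \<in> nonneg_mats"
  shows "orth_proj S X \<in> nonneg_mats"
proof -
  obtain B where B: "independent B" "span B = S"
    and bin: "\<And>M i j. M \<in> B \<Longrightarrow> M $ i $ j \<in> {0, 1}"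
    and ones: "\<Sum>B = (\<chi> i j. 1)"
    using S unfolding partition_subspace_def by blast
  have sub: "subspace S" "S \<subseteq> sym_mats" using S by (auto simp: partition_subspace_def)
  have fin: "finite B" using B(1) by (rule independent_imp_finite)
  define Y where "Y = orth_proj S X"
  have YS: "Y \<in> span B"
    unfolding Y_def B(2) by (rule orth_proj_mem_orthogonal(1)[OF sub X(1)])
  have "0 \<le> Y $ i $ j" for i j
  proof -
    obtain M where M: "M \<in> B" "M $ i $ j = 1"
      using zero_one_partition_at(1)[OF fin bin ones] by blast
    have entry: "Y $ k $ l * M $ k $ l = Y $ i $ j * (M $ k $ l * M $ k $ l)" for k l
      using span_partition_constant_on_part[OF fin bin ones M _ YS, of k l] bin[OF M(1), of k l]
      by auto
    have "Y \<bullet> M = Y $ i $ j * (M \<bullet> M)"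
      by (simp add: inner_vec_def entry sum_distrib_left)
    moreover have "X \<bullet> M = Y \<bullet> M"
      using orth_proj_mem_orthogonal(2)[OF sub X(1), of M] M(1) B(2) span_base[of M B]
      by (simp add: Y_def inner_diff_left)
    moreover have "0 \<le> X $ k $ l * M $ k $ l" for k l
      using X(2) bin[OF M(1), of k l] by (auto simp: nonneg_mats_def)
    then have "0 \<le> X \<bullet> M" by (simp add: inner_vec_def sum_nonneg)
    moreover have "0 < M \<bullet> M" using M(2) by auto
    ultimately show ?thesis by (simp add: zero_le_mult_iff)
  qed
  then show ?thesis by (simp add: nonneg_mats_def Y_def)
qed

theorem corollary3p2:
  fixes C X0 :: "real^'n^'n" and A :: "nat \<Rightarrow> real^'n^'n" and b :: "nat \<Rightarrow> real"
    and m :: nat and S :: "(real^'n^'n) set"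
  assumes "C \<in> sym_mats"
    and "\<And>i. i \<in> {1..m} \<Longrightarrow> A i \<in> sym_mats"
    and "X0 \<in> sym_mats"
    and "\<And>i. i \<in> {1..m} \<Longrightarrow> trace_inner (A i) X0 = b i"
    and "partition_subspace S"
    and "admissible psd_cone C m A X0 S"
  shows "admissible dnn_cone C m A X0 S \<and> partition_subspace S"
proof -
  have "orth_proj S X \<in> dnn_cone" if "X \<in> dnn_cone" for X
  proof -
    have X: "X \<in> psd_cone" "X \<in> sym_mats" "X \<in> nonneg_mats"
      using that by (auto simp: dnn_cone_def psd_cone_def)
    have "orth_proj S X \<in> psd_cone"
      using assms(6) X(1) by (auto simp: admissible_def)
    then show ?thesis
      using partition_subspace_orth_proj_nonneg[OF assms(5) X(2,3)] by (simp add: dnn_cone_def)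
  qed
  then have "orth_proj S ` dnn_cone \<subseteq> dnn_cone" by blast
  then show ?thesis using assms(5,6) unfolding admissible_def by blast
qed

end
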